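(* Let $\hat{\mathcal K}_{ev}=\mathcal K(\hat{\mathcal H})$ be the graded $C^*$-algebra of compact operators on the graded Hilbert space $\hat{\mathcal H}$. Suppose $\sigma$ is a Real structure on $\hat{\mathcal K}_{ev}$. Then $\sigma$ is either of the form $\sigma_{\mathbb R}:T\mapsto J_{\mathbb R}TJ_{\mathbb R}$ for some Real structure $J_{\mathbb R}$ on $\hat{\mathcal H}$, or of the form $\sigma_{\mathbb H}:T\mapsto-J_{\mathbb H}TJ_{\mathbb H}$ for some quaternionic structure $J_{\mathbb H}$ on $\hat{\mathcal H}$.
   Context: $\mathcal H$ is a separable infinite-dimensional complex Hilbert space and $\hat{\mathcal H}=\mathcal H\oplus\mathcal H$ is $\mathbb Z_2$-graded by $(x,y)\mapsto(y,x)$; $\mathcal K(\hat{\mathcal H})$ has the grading given by conjugation with this operator. A Real structure on a graded complex $C^*$-algebra is a conjugate-linear $*$-automorphism $\sigma$ with $\sigma^2=\mathrm{id}$ that commutes with the grading automorphism. A Real structure (resp. quaternionic structure) on $\hat{\mathcal H}$ is a homogeneous (degree 0, i.e. commuting with the grading operator, or degree 1, i.e. anticommuting with it) anti-unitary $J:\hat{\mathcal H}\to\hat{\mathcal H}$ with $J^2=1$ (resp. $J^2=-1$). *)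

theory Defs
  imports "HOL-Analysis.Analysis"
begin

section \<open>Complex Hilbert spaces\<close>

text \<open>A complex inner product space is a real inner product space with a compatible complex
  structure, so that norm and topology are those of the library. The form is conjugate-linear in
  the first and linear in the second argument; positivity and definiteness come from the
  real part.\<close>

class complex_inner = real_inner +
  fixes scaleC :: "complex \<Rightarrow> 'a \<Rightarrow> 'a"
    and cinner :: "'a \<Rightarrow> 'a \<Rightarrow> complex"
  assumes scaleC_add_right: "scaleC c (x + y) = scaleC c x + scaleC c y"
    and scaleC_add_left: "scaleC (c + d) x = scaleC c x + scaleC d x"
    and scaleC_scaleC: "scaleC c (scaleC d x) = scaleC (c * d) x"
    and scaleC_of_real: "scaleC (complex_of_real r) x = scaleR r x"
    and cinner_commute: "cinner x y = cnj (cinner y x)"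
    and cinner_add_right: "cinner x (y + z) = cinner x y + cinner x z"
    and cinner_scaleC_right: "cinner x (scaleC c y) = c * cinner x y"
    and Re_cinner: "Re (cinner x y) = inner x y"

class chilbert_space = complex_inner + complete_space

global_interpretation complex_vector:
  vector_space "scaleC :: complex \<Rightarrow> 'a \<Rightarrow> 'a::complex_inner"
proof
  fix c d :: complex and x y :: 'a
  show "scaleC c (x + y) = scaleC c x + scaleC c y" by (rule scaleC_add_right)
  show "scaleC (c + d) x = scaleC c x + scaleC d x" by (rule scaleC_add_left)
  show "scaleC c (scaleC d x) = scaleC (c * d) x" by (rule scaleC_scaleC)
  show "scaleC 1 x = x" using scaleC_of_real[of 1 x] by simp
qed

instantiation prod :: (complex_inner, complex_inner) complex_inner
begin

definition scaleC_prod_def: "scaleC c p = (scaleC c (fst p), scaleC c (snd p))"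

definition cinner_prod_def: "cinner p q = cinner (fst p) (fst q) + cinner (snd p) (snd q)"

instance
proof
  fix c d :: complex and r :: real and x y z :: "'a \<times> 'b"
  show "scaleC c (x + y) = scaleC c x + scaleC c y"
    by (simp add: scaleC_prod_def scaleC_add_right)
  show "scaleC (c + d) x = scaleC c x + scaleC d x"
    by (simp add: scaleC_prod_def scaleC_add_left)
  show "scaleC c (scaleC d x) = scaleC (c * d) x"
    by (simp add: scaleC_prod_def scaleC_scaleC)
  show "scaleC (complex_of_real r) x = scaleR r x"
    by (simp add: scaleC_prod_def scaleC_of_real scaleR_prod_def)
  show "cinner x y = cnj (cinner y x)"
    by (simp add: cinner_prod_def flip: cinner_commute)
  show "cinner x (y + z) = cinner x y + cinner x z"
    by (simp add: cinner_prod_def cinner_add_right)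
  show "cinner x (scaleC c y) = c * cinner x y"
    by (simp add: cinner_prod_def scaleC_prod_def cinner_scaleC_right distrib_left)
  show "Re (cinner x y) = inner x y"
    by (simp add: cinner_prod_def inner_prod_def Re_cinner)
qed

end

instance prod :: (chilbert_space, chilbert_space) chilbert_space ..

definition infinite_cdim :: "'a::complex_inner itself \<Rightarrow> bool" where
  "infinite_cdim _ \<longleftrightarrow> (\<nexists>B::'a set. finite B \<and> complex_vector.span B = UNIV)"


section \<open>Operators and Real structures on graded algebras of operators\<close>

definition clinear_op :: "('a::complex_inner \<Rightarrow> 'a) \<Rightarrow> bool" where
  "clinear_op T \<longleftrightarrow> (\<forall>x y. T (x + y) = T x + T y) \<and> (\<forall>c x. T (scaleC c x) = scaleC c (T x))"

definition compact_operators :: "('a::complex_inner \<Rightarrow> 'a) set" where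
  "compact_operators = {T. clinear_op T \<and> bounded_linear T \<and> compact (closure (T ` cball 0 1))}"

text \<open>The adjoint exists, and is then unique, for every bounded operator on a Hilbert space; on
  other functions \<open>cadjoint\<close> has no meaning.\<close>

definition cadjoint :: "('a::complex_inner \<Rightarrow> 'a) \<Rightarrow> 'a \<Rightarrow> 'a" where
  "cadjoint T = (THE S. \<forall>x y. cinner (T x) y = cinner x (S y))"

definition conjugation :: "('a \<Rightarrow> 'a) \<Rightarrow> ('a \<Rightarrow> 'a) \<Rightarrow> ('a \<Rightarrow> 'a)" where
  "conjugation \<Gamma> T = \<Gamma> \<circ> T \<circ> inv \<Gamma>"

text \<open>\<open>A\<close> is a C*-algebra of operators with the pointwise linear structure, composition as product
  and \<open>cadjoint\<close> as involution, and \<open>\<alpha>\<close> is its grading automorphism. Only the restriction of \<open>\<sigma>\<close>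
  to \<open>A\<close> is constrained.\<close>

definition conj_linear_star_automorphism ::
  "('a::complex_inner \<Rightarrow> 'a) set \<Rightarrow> (('a \<Rightarrow> 'a) \<Rightarrow> ('a \<Rightarrow> 'a)) \<Rightarrow> bool" where
  "conj_linear_star_automorphism A \<sigma> \<longleftrightarrow>
     bij_betw \<sigma> A A \<and>
     (\<forall>S\<in>A. \<forall>T\<in>A. \<sigma> (\<lambda>x. S x + T x) = (\<lambda>x. \<sigma> S x + \<sigma> T x)) \<and>
     (\<forall>c. \<forall>T\<in>A. \<sigma> (\<lambda>x. scaleC c (T x)) = (\<lambda>x. scaleC (cnj c) (\<sigma> T x))) \<and>
     (\<forall>S\<in>A. \<forall>T\<in>A. \<sigma> (S \<circ> T) = \<sigma> S \<circ> \<sigma> T) \<and>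
     (\<forall>T\<in>A. \<sigma> (cadjoint T) = cadjoint (\<sigma> T))"

definition Real_structure_algebra ::
  "('a::complex_inner \<Rightarrow> 'a) set \<Rightarrow> (('a \<Rightarrow> 'a) \<Rightarrow> ('a \<Rightarrow> 'a)) \<Rightarrow>
   (('a \<Rightarrow> 'a) \<Rightarrow> ('a \<Rightarrow> 'a)) \<Rightarrow> bool" where
  "Real_structure_algebra A \<alpha> \<sigma> \<longleftrightarrow>
     conj_linear_star_automorphism A \<sigma> \<and>
     (\<forall>T\<in>A. \<sigma> (\<sigma> T) = T) \<and>
     (\<forall>T\<in>A. \<sigma> (\<alpha> T) = \<alpha> (\<sigma> T))"


section \<open>Real and quaternionic structures on graded Hilbert spaces\<close>

definition antiunitary :: "('a::complex_inner \<Rightarrow> 'a) \<Rightarrow> bool" where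
  "antiunitary J \<longleftrightarrow>
     (\<forall>x y. J (x + y) = J x + J y) \<and>
     (\<forall>c x. J (scaleC c x) = scaleC (cnj c) (J x)) \<and>
     (\<forall>x y. cinner (J x) (J y) = cnj (cinner x y)) \<and>
     surj J"

definition homogeneous :: "('a::complex_inner \<Rightarrow> 'a) \<Rightarrow> ('a \<Rightarrow> 'a) \<Rightarrow> bool" where
  "homogeneous \<Gamma> J \<longleftrightarrow> (\<forall>x. J (\<Gamma> x) = \<Gamma> (J x)) \<or> (\<forall>x. J (\<Gamma> x) = - \<Gamma> (J x))"

definition Real_structure_space :: "('a::complex_inner \<Rightarrow> 'a) \<Rightarrow> ('a \<Rightarrow> 'a) \<Rightarrow> bool" where
  "Real_structure_space \<Gamma> J \<longleftrightarrow> antiunitary J \<and> homogeneous \<Gamma> J \<and> (\<forall>x. J (J x) = x)"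

definition quaternionic_structure_space :: "('a::complex_inner \<Rightarrow> 'a) \<Rightarrow> ('a \<Rightarrow> 'a) \<Rightarrow> bool" where
  "quaternionic_structure_space \<Gamma> J \<longleftrightarrow> antiunitary J \<and> homogeneous \<Gamma> J \<and> (\<forall>x. J (J x) = - x)"

text \<open>The grading operator \<open>(x, y) \<mapsto> (y, x)\<close> of \<open>H \<oplus> H\<close> is \<^const>\<open>prod.swap\<close>; the direct sum is the
  product type with the inner product above.\<close>

abbreviation Khat_grading ::
  "('h::complex_inner \<times> 'h \<Rightarrow> 'h \<times> 'h) \<Rightarrow> ('h \<times> 'h \<Rightarrow> 'h \<times> 'h)" where
  "Khat_grading \<equiv> conjugation prod.swap"

end

theory Submission
  imports Defs
begin

text \<open>
  The heart of the matter is that every conjugate-linear \<open>*\<close>-automorphism \<open>\<sigma>\<close> of the compact operators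
  on a non-zero Hilbert space is spatial: \<open>\<sigma> T = U T U\<^sup>-\<^sup>1\<close> for an anti-unitary \<open>U\<close>
  (\<open>conj_linear_star_automorphism_spatial\<close>). A rank-one projection \<open>P\<close> onto a unit vector \<open>e\<close> is a
  minimal projection, i.e. \<open>P T P\<close> is always a multiple of \<open>P\<close>. This is an algebraic property, so
  \<open>\<sigma> P\<close> is again the projection onto a unit vector \<open>f\<close>, and \<open>U\<close> is forced: the operator
  \<open>z \<mapsto> \<langle>e, z\<rangle> a\<close> carries \<open>e\<close> to \<open>a\<close>, so its image under \<open>\<sigma>\<close> must carry \<open>f\<close> to \<open>U a\<close>.

  The implementing \<open>U\<close> is unique up to a phase, because a map commuting with all rank-one operators
  is a scalar (\<open>commutes_with_rank_one_scalar\<close>). Both remaining hypotheses say that two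
  implementations of one automorphism agree. From \<open>\<sigma>\<^sup>2 = id\<close> it follows that \<open>U\<^sup>2\<close> is a scalar \<open>c\<close>;
  as \<open>U\<close> commutes with \<open>U\<^sup>2\<close> and is anti-linear, \<open>c\<close> is real, so \<open>c = 1\<close> or \<open>c = -1\<close>, which is the Real and
  the quaternionic case. From compatibility with the grading it follows that \<open>\<Gamma> U \<Gamma> = d U\<close> for a
  scalar \<open>d\<close>, and \<open>\<Gamma>\<^sup>2 = 1\<close> gives \<open>d = 1\<close> or \<open>d = -1\<close>, which is homogeneity.
\<close>

section \<open>The complex inner product and adjoints\<close>

lemma cinner_scaleC_left: "cinner (scaleC c x) y = cnj c * cinner x (y::'a::complex_inner)"
  by (metis cinner_scaleC_right cinner_commute complex_cnj_mult)

lemma cinner_self: "cinner x x = complex_of_real ((norm (x::'a::complex_inner))\<^sup>2)"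
proof -
  have "Im (cinner x x) = 0"
    using cinner_commute[of x x] by (metis Reals_cnj_iff complex_is_Real_iff)
  then show ?thesis
    by (simp add: complex_eq_iff Re_cinner power2_norm_eq_inner)
qed

lemma scaleC_minus1: "scaleC (-1) x = - (x::'a::complex_inner)"
  using scaleC_of_real[of "-1" x] by simp

lemma cinner_eqI:
  fixes y z :: "'a::complex_inner"
  assumes "\<And>x. cinner x y = cinner x z"
  shows "y = z"
proof -
  have "inner (y - z) y = inner (y - z) z"
    using assms[of "y - z"] by (metis Re_cinner)
  then have "inner (y - z) (y - z) = 0"
    by (simp add: inner_diff_right)
  then show ?thesis by simp
qed

lemma norm_scaleC: "norm (scaleC c x) = cmod c * norm (x::'a::complex_inner)"
proof -
  have "complex_of_real ((norm (scaleC c x))\<^sup>2) = cnj c * (c * cinner x x)"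
    unfolding cinner_self[symmetric] by (simp add: cinner_scaleC_left cinner_scaleC_right)
  also have "\<dots> = complex_of_real ((cmod c * norm x)\<^sup>2)"
    by (simp add: cinner_self power_mult_distrib complex_norm_square ac_simps del: of_real_power)
  finally have "(norm (scaleC c x))\<^sup>2 = (cmod c * norm x)\<^sup>2"
    using of_real_eq_iff by blast
  then show ?thesis by simp
qed

text \<open>Replacing \<open>x\<close> by its multiple \<open>\<langle>x, y\<rangle> x\<close> makes the inner product real, where the real
  Cauchy-Schwarz inequality applies.\<close>

lemma cmod_cinner_le: "cmod (cinner x y) \<le> norm x * norm (y::'a::complex_inner)"
proof (cases "cinner x y = 0")
  case False
  let ?c = "cinner x y"
  have "complex_of_real ((cmod ?c)\<^sup>2) = cinner (scaleC ?c x) y"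
    unfolding cinner_scaleC_left complex_norm_square by (simp add: mult.commute)
  then have "(cmod ?c)\<^sup>2 = inner (scaleC ?c x) y"
    by (metis Re_cinner Re_complex_of_real)
  also have "\<dots> \<le> norm (scaleC ?c x) * norm y"
    by (rule norm_cauchy_schwarz)
  finally have "cmod ?c * cmod ?c \<le> cmod ?c * (norm x * norm y)"
    by (simp add: norm_scaleC power2_eq_square mult.assoc)
  then show ?thesis using False by simp
qed simp

text \<open>The representing vector of \<open>\<phi>\<close> is the minimiser of the functional \<open>g x = |x|\<^sup>2 - 2 \<phi> x\<close>: the
  parallelogram law makes minimising sequences Cauchy, and at a minimum the derivative
  \<open>2 (\<langle>y, z\<rangle> - \<phi> z)\<close> in every direction \<open>z\<close> vanishes.\<close>

lemma riesz_representation_real: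
  fixes \<phi> :: "'a::{real_inner,complete_space} \<Rightarrow> real"
  assumes "bounded_linear \<phi>"
  obtains y where "\<And>z. \<phi> z = inner y z"
proof -
  interpret \<phi>: bounded_linear \<phi> by fact
  define g where "g x = inner x x - 2 * \<phi> x" for x
  obtain K where K: "\<And>x. norm (\<phi> x) \<le> norm x * K"
    using \<phi>.bounded by blast
  have lower: "- K\<^sup>2 \<le> g x" for x
  proof -
    have "\<phi> x \<le> norm x * K"
      using K[of x] by simp
    moreover have "0 \<le> (norm x - K)\<^sup>2"
      by simp
    ultimately show ?thesis
      unfolding g_def power2_norm_eq_inner[symmetric] by (simp add: power2_diff)
  qed
  define m where "m = Inf (range g)"
  have bdd: "bdd_below (range g)"
    using lower by (intro bdd_belowI[of _ "- K\<^sup>2"]) auto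
  have m_le: "m \<le> g x" for x
    unfolding m_def using bdd by (simp add: cINF_lower)
  define \<epsilon> :: "nat \<Rightarrow> real" where "\<epsilon> n = inverse (real (Suc n))" for n
  have "\<exists>x. g x < m + \<epsilon> n" for n
    using cInf_lessD[of "range g" "m + \<epsilon> n"] by (auto simp: m_def \<epsilon>_def)
  then obtain X where X: "\<And>n. g (X n) < m + \<epsilon> n"
    by metis
  have parallelogram: "(norm (x - y))\<^sup>2 = 2 * (g x + g y) - 4 * g ((1/2) *\<^sub>R (x + y))" for x y
    unfolding g_def power2_norm_eq_inner
    by (simp add: \<phi>.scaleR \<phi>.add inner_add_left inner_add_right inner_diff_left inner_diff_right
        inner_commute algebra_simps)
  have close: "(norm (X i - X j))\<^sup>2 < 4 * \<epsilon> N" if "N \<le> i" "N \<le> j" for i j N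
  proof -
    have "\<epsilon> i \<le> \<epsilon> N" "\<epsilon> j \<le> \<epsilon> N"
      using that by (auto simp: \<epsilon>_def intro!: le_imp_inverse_le)
    moreover have "(norm (X i - X j))\<^sup>2 \<le> 2 * (g (X i) + g (X j)) - 4 * m"
      unfolding parallelogram using m_le by simp
    ultimately show ?thesis
      using X[of i] X[of j] by (simp add: algebra_simps)
  qed
  have "Cauchy X"
  proof (rule metric_CauchyI)
    fix e :: real assume "0 < e"
    then have "0 < e\<^sup>2 / 4" by simp
    then obtain N where N: "\<epsilon> N < e\<^sup>2 / 4"
      unfolding \<epsilon>_def using reals_Archimedean by blast
    have "dist (X i) (X j) < e" if "N \<le> i" "N \<le> j" for i j
    proof -
      have "(norm (X i - X j))\<^sup>2 < e\<^sup>2"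
        using close[OF that] N by linarith
      then show ?thesis
        using \<open>0 < e\<close> by (simp add: dist_norm power_less_imp_less_base)
    qed
    then show "\<exists>M. \<forall>i\<ge>M. \<forall>j\<ge>M. dist (X i) (X j) < e" by blast
  qed
  then obtain y where y: "X \<longlonglongrightarrow> y"
    using Cauchy_convergent convergent_def by blast
  have "(\<lambda>n. g (X n)) \<longlonglongrightarrow> g y"
    unfolding g_def by (intro tendsto_intros y \<phi>.tendsto)
  moreover have "(\<lambda>n. m + \<epsilon> n) \<longlonglongrightarrow> m + 0"
    unfolding \<epsilon>_def by (intro tendsto_intros LIMSEQ_inverse_real_of_nat)
  ultimately have "g y \<le> m + 0"
    by (rule LIMSEQ_le) (use X less_imp_le in blast)
  then have min: "g y \<le> g x" for x
    using m_le[of x] by linarith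
  have "\<phi> z = inner y z" for z
  proof -
    define d where "d = inner y z - \<phi> z"
    define N where "N = inner z z"
    have "0 \<le> N" by (simp add: N_def)
    have expand: "g (y + t *\<^sub>R z) = g y + 2 * t * d + t\<^sup>2 * N" for t
      unfolding g_def d_def N_def
      by (simp add: \<phi>.scaleR \<phi>.add inner_add_left inner_add_right inner_commute
          algebra_simps power2_eq_square)
    \<comment> \<open>This step is slightly shorter than the minimising one \<open>- d / N\<close>, and meaningful for \<open>N = 0\<close> too.\<close>
    define t where "t = - d / (N + 1)"
    have td: "d = - t * (N + 1)"
      using \<open>0 \<le> N\<close> by (simp add: t_def)
    have "0 \<le> 2 * t * d + t\<^sup>2 * N"
      using min[of "y + t *\<^sub>R z"] expand[of t] by linarith
    also have "\<dots> = - (t\<^sup>2 * (N + 2))"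
      unfolding td by (simp add: power2_eq_square algebra_simps)
    finally have "t\<^sup>2 * (N + 2) \<le> 0" by simp
    then have "t\<^sup>2 \<le> 0"
      using \<open>0 \<le> N\<close> by (simp add: mult_le_0_iff)
    then have "t = 0" by simp
    then show ?thesis using td by (simp add: d_def)
  qed
  then show thesis by (rule that)
qed

lemma cadjoint_eqI:
  fixes T :: "'a::complex_inner \<Rightarrow> 'a"
  assumes "\<And>x y. cinner (T x) y = cinner x (S y)"
  shows "cadjoint T = S"
  unfolding cadjoint_def
proof (rule the_equality)
  fix S' assume S': "\<forall>x y. cinner (T x) y = cinner x (S' y)"
  show "S' = S"
  proof (intro ext cinner_eqI)
    fix y x show "cinner x (S' y) = cinner x (S y)"
      using S' assms by metis
  qed
qed (use assms in blast)

lemma cinner_cadjoint: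
  fixes T :: "'a::chilbert_space \<Rightarrow> 'a"
  assumes "clinear_op T" and "bounded_linear T"
  shows "cinner (T x) y = cinner x (cadjoint T y)"
proof -
  have "\<exists>w. \<forall>x. cinner (T x) y = cinner x w" for y
  proof -
    have "bounded_linear (\<lambda>x. inner (T x) y)"
      using assms(2) bounded_linear_compose bounded_linear_inner_left by blast
    then obtain w where w: "\<And>x. inner (T x) y = inner w x"
      using riesz_representation_real[of "\<lambda>x. inner (T x) y"] by metis
    have Re_eq: "Re (cinner (T x) y) = Re (cinner x w)" for x
      using w by (simp add: Re_cinner inner_commute)
    \<comment> \<open>Both sides are conjugate-linear in \<open>x\<close>, so the imaginary part is the real part at \<open>\<i> x\<close>.\<close>
    have "Im (cinner (T x) y) = Im (cinner x w)" for x
      using Re_eq[of "scaleC \<i> x"] assms(1) by (simp add: clinear_op_def cinner_scaleC_left)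
    then show ?thesis using Re_eq by (metis complex_eqI)
  qed
  then obtain S where S: "\<And>x y. cinner (T x) y = cinner x (S y)"
    by metis
  then have "cadjoint T = S"
    by (rule cadjoint_eqI)
  then show ?thesis using S by simp
qed


section \<open>Rank-one operators\<close>

definition rank_one :: "'a::complex_inner \<Rightarrow> 'a \<Rightarrow> 'a \<Rightarrow> 'a" where
  "rank_one x y = (\<lambda>z. scaleC (cinner y z) x)"

lemma rank_one_compact: "rank_one x y \<in> compact_operators"
proof -
  have lin: "clinear_op (rank_one x y)"
    by (simp add: clinear_op_def rank_one_def cinner_add_right scaleC_add_left cinner_scaleC_right
        scaleC_scaleC)
  have "bounded_linear (rank_one x y)"
  proof (rule bounded_linear_intro)
    show "rank_one x y (u + v) = rank_one x y u + rank_one x y v" for u v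
      using lin by (simp add: clinear_op_def)
    show "rank_one x y (r *\<^sub>R v) = r *\<^sub>R rank_one x y v" for r v
      using lin by (simp add: clinear_op_def flip: scaleC_of_real)
    show "norm (rank_one x y v) \<le> norm v * (norm y * norm x)" for v
      using mult_right_mono[OF cmod_cinner_le[of y v], of "norm x"]
      by (simp add: rank_one_def norm_scaleC ac_simps)
  qed
  moreover have "compact (closure (rank_one x y ` cball 0 1))"
  proof -
    have "bounded_linear (\<lambda>c. scaleC c x)"
      by (rule bounded_linear_intro[of _ "norm x"])
        (simp_all add: scaleC_add_left norm_scaleC scaleC_scaleC scaleR_conv_of_real
          flip: scaleC_of_real)
    then have comp: "compact ((\<lambda>c. scaleC c x) ` cball 0 (norm y))"
      by (intro compact_continuous_image linear_continuous_on compact_cball)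
    have "rank_one x y ` cball 0 1 \<subseteq> (\<lambda>c. scaleC c x) ` cball 0 (norm y)"
    proof
      fix w assume "w \<in> rank_one x y ` cball 0 1"
      then obtain z where z: "norm z \<le> 1" "w = scaleC (cinner y z) x"
        by (auto simp: rank_one_def)
      have "cmod (cinner y z) \<le> norm y"
        using cmod_cinner_le[of y z] mult_left_mono[OF z(1), of "norm y"] by simp
      then show "w \<in> (\<lambda>c. scaleC c x) ` cball 0 (norm y)"
        using z by auto
    qed
    then have "closure (rank_one x y ` cball 0 1) \<subseteq> (\<lambda>c. scaleC c x) ` cball 0 (norm y)"
      by (rule closure_minimal) (rule compact_imp_closed[OF comp])
    then show ?thesis
      using compact_Int_closed[OF comp closed_closure] by (metis inf.absorb2)
  qed
  ultimately show ?thesis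
    using lin by (simp add: compact_operators_def)
qed

lemma cadjoint_rank_one: "cadjoint (rank_one x y) = rank_one y x"
  by (rule cadjoint_eqI)
    (simp add: rank_one_def cinner_scaleC_left cinner_scaleC_right mult.commute flip: cinner_commute)

lemma rank_one_apply_unit: "norm e = 1 \<Longrightarrow> rank_one x e e = x"
  by (simp add: rank_one_def cinner_self)

lemma comp_rank_one: "clinear_op T \<Longrightarrow> T \<circ> rank_one x y = rank_one (T x) y"
  by (auto simp: rank_one_def clinear_op_def)

text \<open>Apply \<open>V\<close> to \<open>x\<close> written as \<open>rank_one x e e\<close>.\<close>

lemma commutes_with_rank_one_scalar:
  fixes V :: "'a::complex_inner \<Rightarrow> 'a"
  assumes "\<And>x y z. V (rank_one x y z) = rank_one x y (V z)" and "norm e = 1"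
  shows "V x = scaleC (cinner e (V e)) x"
  using assms(1)[of x e e] assms(2) by (simp add: rank_one_apply_unit) (simp add: rank_one_def)


section \<open>Automorphisms of the compact operators are spatial\<close>

text \<open>Minimality of the projection \<open>P\<close> onto \<open>e\<close>, that is \<open>P T P = \<langle>e, T e\<rangle> P\<close>, passes to \<open>\<sigma> P\<close>
  because \<open>\<sigma>\<close> is onto. Compressing the projection onto any unit vector in the range of \<open>\<sigma> P\<close> then
  shows that this range is one-dimensional, and a self-adjoint idempotent of rank one is an
  orthogonal projection.\<close>

lemma image_of_rank_one_projection:
  fixes \<sigma> :: "('a::chilbert_space \<Rightarrow> 'a) \<Rightarrow> ('a \<Rightarrow> 'a)"
  assumes \<sigma>: "conj_linear_star_automorphism compact_operators \<sigma>" and e: "norm e = 1"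
  obtains f where "norm f = 1" and "\<sigma> (rank_one e e) = rank_one f f"
proof -
  define P where "P = rank_one e e"
  define Q where "Q = \<sigma> P"
  have bij: "bij_betw \<sigma> compact_operators compact_operators"
    and scale: "\<And>c T. T \<in> compact_operators \<Longrightarrow>
      \<sigma> (\<lambda>x. scaleC c (T x)) = (\<lambda>x. scaleC (cnj c) (\<sigma> T x))"
    and mult: "\<And>S T. S \<in> compact_operators \<Longrightarrow> T \<in> compact_operators \<Longrightarrow> \<sigma> (S \<circ> T) = \<sigma> S \<circ> \<sigma> T"
    and star: "\<And>T. T \<in> compact_operators \<Longrightarrow> \<sigma> (cadjoint T) = cadjoint (\<sigma> T)"
    using \<sigma> unfolding conj_linear_star_automorphism_def by blast+
  have PK: "P \<in> compact_operators"
    unfolding P_def by (rule rank_one_compact)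
  have QK: "Q \<in> compact_operators"
    unfolding Q_def using bij PK by (rule bij_betw_apply)
  then have lin: "clinear_op Q" and bdd: "bounded_linear Q"
    by (auto simp: compact_operators_def)
  have selfadj: "cinner (Q x) y = cinner x (Q y)" for x y
    using cinner_cadjoint[OF lin bdd] star[OF PK]
    by (simp add: Q_def P_def cadjoint_rank_one)
  have "P \<circ> P = P"
    using comp_rank_one[of P e e] PK e
    by (simp add: P_def compact_operators_def rank_one_apply_unit)
  then have idem: "Q (Q x) = Q x" for x
    using mult[OF PK PK] by (metis Q_def comp_apply)
  have minimal: "\<exists>c. \<forall>x. Q (S (Q x)) = scaleC c (Q x)" if S: "S \<in> compact_operators" for S
  proof -
    obtain T where T: "T \<in> compact_operators" "S = \<sigma> T"
      using bij S by (auto simp: bij_betw_def)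
    have linT: "clinear_op T" using T by (simp add: compact_operators_def)
    have TP: "T \<circ> P = rank_one (T e) e"
      unfolding P_def using linT by (rule comp_rank_one)
    then have PTP: "P \<circ> (T \<circ> P) = (\<lambda>x. scaleC (cinner e (T e)) (P x))"
      by (auto simp: rank_one_def P_def cinner_scaleC_right scaleC_scaleC mult.commute)
    have "Q \<circ> (S \<circ> Q) = \<sigma> (P \<circ> (T \<circ> P))"
      using mult[OF PK, of "T \<circ> P"] mult[OF T(1) PK] TP rank_one_compact[of "T e" e]
      by (simp add: Q_def T(2))
    also have "\<dots> = (\<lambda>x. scaleC (cnj (cinner e (T e))) (Q x))"
      unfolding PTP Q_def by (rule scale[OF PK])
    finally show ?thesis
      by (metis comp_apply)
  qed
  have "\<exists>w. Q w \<noteq> 0"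
  proof (rule ccontr)
    assume "\<not> (\<exists>w. Q w \<noteq> 0)"
    then have "\<sigma> P = \<sigma> (\<lambda>x. scaleC 0 (P x))"
      using scale[OF PK, of 0] by (auto simp: Q_def)
    moreover have "(\<lambda>x. scaleC 0 (P x)) = rank_one 0 e"
      by (auto simp: rank_one_def)
    ultimately have "P = rank_one 0 e"
      using bij PK rank_one_compact by (metis bij_betw_def inj_onD)
    then have "P e = 0" by (simp add: rank_one_def)
    moreover have "P e = e" using e by (simp add: P_def rank_one_apply_unit)
    ultimately show False using e by simp
  qed
  then obtain w where w: "Q w \<noteq> 0" by blast
  define f where "f = scaleC (complex_of_real (inverse (norm (Q w)))) (Q w)"
  have f: "norm f = 1"
    using w by (simp add: f_def norm_scaleC norm_inverse)
  have Qf: "Q f = f"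
    using lin idem by (simp add: f_def clinear_op_def)
  obtain c where c: "\<And>x. Q (rank_one f f (Q x)) = scaleC c (Q x)"
    using minimal[OF rank_one_compact] by blast
  have Q_eq: "rank_one f f x = scaleC c (Q x)" for x
  proof -
    have "Q (rank_one f f (Q x)) = scaleC (cinner (Q f) x) (Q f)"
      using lin selfadj[of f x] by (simp add: clinear_op_def rank_one_def)
    then show ?thesis using c[of x] Qf by (simp add: rank_one_def)
  qed
  have "scaleC c f = scaleC 1 f"
    using Q_eq[of f] Qf f by (simp add: rank_one_apply_unit)
  moreover have "f \<noteq> 0" using f by auto
  ultimately have "c = 1"
    using complex_vector.scale_right_imp_eq by blast
  then have "Q = rank_one f f"
    using Q_eq by auto
  then show thesis
    using that f unfolding Q_def P_def by blast
qed

text \<open>With \<open>\<theta> a\<close> for \<open>rank_one a e\<close>, put \<open>U a = \<sigma> (\<theta> a) f\<close>. The relations used are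
  \<open>T \<theta>(a) = \<theta>(T a)\<close>, which gives the intertwining property, and \<open>\<theta>(a)\<^sup>* \<theta>(b) = \<langle>a, b\<rangle> \<theta>(e)\<close>, which
  gives the compatibility with inner products. A vector \<open>v\<close>
  is \<open>\<sigma> R f\<close>, hence \<open>U (R e)\<close>, for the preimage \<open>R\<close> of \<open>rank_one v f\<close>.\<close>

proposition conj_linear_star_automorphism_spatial:
  fixes \<sigma> :: "('a::chilbert_space \<Rightarrow> 'a) \<Rightarrow> ('a \<Rightarrow> 'a)"
  assumes \<sigma>: "conj_linear_star_automorphism compact_operators \<sigma>" and e: "norm (e::'a) = 1"
  obtains U where "antiunitary U"
    and "\<And>T x. T \<in> compact_operators \<Longrightarrow> \<sigma> T (U x) = U (T x)"
proof -
  have bij: "bij_betw \<sigma> compact_operators compact_operators"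
    and add: "\<And>S T. S \<in> compact_operators \<Longrightarrow> T \<in> compact_operators \<Longrightarrow>
      \<sigma> (\<lambda>x. S x + T x) = (\<lambda>x. \<sigma> S x + \<sigma> T x)"
    and scale: "\<And>c T. T \<in> compact_operators \<Longrightarrow>
      \<sigma> (\<lambda>x. scaleC c (T x)) = (\<lambda>x. scaleC (cnj c) (\<sigma> T x))"
    and mult: "\<And>S T. S \<in> compact_operators \<Longrightarrow> T \<in> compact_operators \<Longrightarrow> \<sigma> (S \<circ> T) = \<sigma> S \<circ> \<sigma> T"
    and star: "\<And>T. T \<in> compact_operators \<Longrightarrow> \<sigma> (cadjoint T) = cadjoint (\<sigma> T)"
    using \<sigma> unfolding conj_linear_star_automorphism_def by blast+
  have K: "rank_one x y \<in> compact_operators" for x y :: 'a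
    by (rule rank_one_compact)
  obtain f where f: "norm f = 1" and \<sigma>e: "\<sigma> (rank_one e e) = rank_one f f"
    using image_of_rank_one_projection[OF \<sigma> e] by blast
  define U where "U a = \<sigma> (rank_one a e) f" for a
  have inter: "\<sigma> T (U x) = U (T x)" if T: "T \<in> compact_operators" for T x
  proof -
    have "T \<circ> rank_one x e = rank_one (T x) e"
      using T by (intro comp_rank_one) (simp add: compact_operators_def)
    then show ?thesis
      using mult[OF T K, of x e] by (metis U_def comp_apply)
  qed
  have "antiunitary U"
    unfolding antiunitary_def
  proof (intro conjI allI)
    show "U (x + y) = U x + U y" for x y
    proof -
      have "rank_one (x + y) e = (\<lambda>z. rank_one x e z + rank_one y e z)"
        by (auto simp: rank_one_def scaleC_add_right)
      then show ?thesis using add[OF K K] by (simp add: U_def)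
    qed
    show "U (scaleC c x) = scaleC (cnj c) (U x)" for c x
    proof -
      have "rank_one (scaleC c x) e = (\<lambda>z. scaleC c (rank_one x e z))"
        by (auto simp: rank_one_def scaleC_scaleC mult.commute)
      then show ?thesis using scale[OF K] by (simp add: U_def)
    qed
    show "cinner (U x) (U y) = cnj (cinner x y)" for x y
    proof -
      have "\<sigma> (rank_one x e) \<in> compact_operators"
        using bij K by (rule bij_betw_apply)
      then have "cinner (U x) (U y) = cinner f (cadjoint (\<sigma> (rank_one x e)) (U y))"
        unfolding U_def by (intro cinner_cadjoint) (auto simp: compact_operators_def)
      also have "\<dots> = cinner f (\<sigma> (rank_one e x) (U y))"
        using star[OF K, of x e] by (simp add: cadjoint_rank_one)
      also have "\<dots> = cinner f (U (rank_one e x y))"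
        by (simp add: inter[OF K])
      also have "U (rank_one e x y) = \<sigma> (\<lambda>z. scaleC (cinner x y) (rank_one e e z)) f"
        unfolding U_def by (rule arg_cong[of _ _ "\<lambda>T. \<sigma> T f"])
          (auto simp: rank_one_def scaleC_scaleC mult.commute)
      also have "\<dots> = scaleC (cnj (cinner x y)) f"
        using scale[OF K] \<sigma>e f by (simp add: rank_one_apply_unit)
      finally show ?thesis using f by (simp add: cinner_scaleC_right cinner_self)
    qed
    show "surj U"
    proof (rule surjI)
      fix v
      let ?R = "inv_into compact_operators \<sigma> (rank_one v f)"
      have R: "?R \<in> compact_operators" "\<sigma> ?R = rank_one v f"
        using bij K by (auto simp: bij_betw_def inv_into_into f_inv_into_f)
      have "U e = f"
        using \<sigma>e f by (simp add: U_def rank_one_apply_unit)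
      then show "U (?R e) = v"
        using inter[OF R(1), of e] R(2) f by (simp add: rank_one_apply_unit)
    qed
  qed
  then show thesis using inter by (rule that)
qed


section \<open>Real structures\<close>

proposition Real_structure_algebra_spatial:
  fixes \<sigma> :: "('a::chilbert_space \<Rightarrow> 'a) \<Rightarrow> ('a \<Rightarrow> 'a)" and \<Gamma> :: "'a \<Rightarrow> 'a"
  assumes \<sigma>: "Real_structure_algebra compact_operators (conjugation \<Gamma>) \<sigma>"
    and \<Gamma>: "clinear_op \<Gamma>" "\<And>x. \<Gamma> (\<Gamma> x) = x" "\<And>x y. cinner (\<Gamma> x) (\<Gamma> y) = cinner x y"
    and e: "norm (e::'a) = 1"
  shows "(\<exists>J. Real_structure_space \<Gamma> J \<and> (\<forall>T\<in>compact_operators. \<sigma> T = (\<lambda>x. J (T (J x))))) \<or>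
         (\<exists>J. quaternionic_structure_space \<Gamma> J \<and>
             (\<forall>T\<in>compact_operators. \<sigma> T = (\<lambda>x. - J (T (J x)))))"
proof -
  have aut: "conj_linear_star_automorphism compact_operators \<sigma>"
    and invol: "\<And>T. T \<in> compact_operators \<Longrightarrow> \<sigma> (\<sigma> T) = T"
    and graded: "\<And>T. T \<in> compact_operators \<Longrightarrow> \<sigma> (conjugation \<Gamma> T) = conjugation \<Gamma> (\<sigma> T)"
    using \<sigma> unfolding Real_structure_algebra_def by blast+
  obtain U where U: "antiunitary U"
    and inter: "\<And>T x. T \<in> compact_operators \<Longrightarrow> \<sigma> T (U x) = U (T x)"
    using conj_linear_star_automorphism_spatial[OF aut e] by blast
  have U_scale: "U (scaleC c x) = scaleC (cnj c) (U x)" for c x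
    using U by (simp add: antiunitary_def)
  have U_norm: "norm (U x) = norm x" for x
  proof -
    have "complex_of_real ((norm (U x))\<^sup>2) = complex_of_real ((norm x)\<^sup>2)"
      using U cinner_self[of x] cinner_self[of "U x"] by (simp add: antiunitary_def)
    then have "(norm (U x))\<^sup>2 = (norm x)\<^sup>2" using of_real_eq_iff by blast
    then show ?thesis by simp
  qed
  have \<sigma>K: "\<sigma> T \<in> compact_operators" if "T \<in> compact_operators" for T
  proof -
    have "bij_betw \<sigma> compact_operators compact_operators"
      using aut by (simp only: conj_linear_star_automorphism_def)
    then show ?thesis using that by (rule bij_betw_apply)
  qed
  have scalar_unique: "c = d" if "scaleC c (x::'a) = scaleC d x" "norm x = 1" for c d x
    using that complex_vector.scale_right_imp_eq[of x c d] by fastforce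

  define c where "c = cinner e (U (U e))"
  have "U (U (rank_one x y z)) = rank_one x y (U (U z))" for x y z
    using inter[OF rank_one_compact] inter[OF \<sigma>K[OF rank_one_compact]]
      invol[OF rank_one_compact] by metis
  then have UU: "U (U x) = scaleC c x" for x
    unfolding c_def using commutes_with_rank_one_scalar[of "\<lambda>x. U (U x)"] e by blast
  have "scaleC (cnj c) (U e) = scaleC c (U e)"
    using UU[of "U e"] UU[of e] U_scale by simp
  then have "cnj c = c"
    by (rule scalar_unique) (simp add: U_norm e)
  moreover have "cmod c = 1"
    using UU[of e] U_norm e by (metis mult.right_neutral norm_scaleC)
  moreover have "c * cnj c = complex_of_real ((cmod c)\<^sup>2)"
    by (rule complex_norm_square[symmetric])
  ultimately have "c * c = 1" by simp
  then have c: "c = 1 \<or> c = -1"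
    by (simp add: square_eq_1_iff)

  have inv_\<Gamma>: "inv \<Gamma> = \<Gamma>"
    using \<Gamma>(2) by (intro inv_unique_comp) auto
  have \<Gamma>_scale: "\<Gamma> (scaleC k x) = scaleC k (\<Gamma> x)" for k x
    using \<Gamma>(1) by (simp add: clinear_op_def)
  have \<Gamma>_rank_one: "conjugation \<Gamma> (rank_one x y) = rank_one (\<Gamma> x) (\<Gamma> y)" for x y
  proof
    fix z
    have "cinner y (\<Gamma> z) = cinner (\<Gamma> y) z"
      using \<Gamma>(3)[of y "\<Gamma> z"] by (simp add: \<Gamma>(2))
    then show "conjugation \<Gamma> (rank_one x y) z = rank_one (\<Gamma> x) (\<Gamma> y) z"
      by (simp add: conjugation_def inv_\<Gamma> rank_one_def \<Gamma>_scale)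
  qed
  \<comment> \<open>\<open>\<Gamma> U \<Gamma>\<close> implements \<open>\<sigma>\<close> as well; its comparison with \<open>U\<close> uses \<open>U\<close> in place of \<open>U\<^sup>-\<^sup>1\<close>, the two
    being proportional.\<close>
  define V where "V x = U (\<Gamma> (U (\<Gamma> x)))" for x
  have "V (rank_one x y z) = rank_one x y (V z)" for x y z
  proof -
    have "\<Gamma> (rank_one x y z) = rank_one (\<Gamma> x) (\<Gamma> y) (\<Gamma> z)"
      by (simp add: rank_one_def \<Gamma>_scale \<Gamma>(3))
    then have "U (\<Gamma> (rank_one x y z)) = \<sigma> (conjugation \<Gamma> (rank_one x y)) (U (\<Gamma> z))"
      by (simp add: \<Gamma>_rank_one inter[OF rank_one_compact])
    also have "\<dots> = \<Gamma> (\<sigma> (rank_one x y) (\<Gamma> (U (\<Gamma> z))))"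
      unfolding graded[OF rank_one_compact] by (simp add: conjugation_def inv_\<Gamma>)
    finally have "V (rank_one x y z) = U (\<sigma> (rank_one x y) (\<Gamma> (U (\<Gamma> z))))"
      by (simp add: V_def \<Gamma>(2))
    also have "\<dots> = rank_one x y (V z)"
      using inter[OF \<sigma>K[OF rank_one_compact]] invol[OF rank_one_compact] by (metis V_def)
    finally show ?thesis .
  qed
  then have V: "V x = scaleC (cinner e (V e)) x" for x
    using commutes_with_rank_one_scalar[of V] e by blast
  obtain d where d: "\<And>x. \<Gamma> (U (\<Gamma> x)) = scaleC d (U x)"
  proof
    fix x
    have "scaleC c (\<Gamma> (U (\<Gamma> x))) = U (V x)"
      by (simp add: V_def UU)
    also have "\<dots> = scaleC (cnj (cinner e (V e))) (U x)"
      by (subst V) (rule U_scale)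
    finally have "scaleC (c * c) (\<Gamma> (U (\<Gamma> x))) = scaleC (c * cnj (cinner e (V e))) (U x)"
      by (metis scaleC_scaleC)
    moreover have "c * c = 1" using c by auto
    ultimately show "\<Gamma> (U (\<Gamma> x)) = scaleC (c * cnj (cinner e (V e))) (U x)"
      by simp
  qed
  have "U e = \<Gamma> (\<Gamma> (U (\<Gamma> (\<Gamma> e))))"
    by (simp add: \<Gamma>(2))
  also have "\<dots> = scaleC (d * d) (U e)"
    by (simp only: d \<Gamma>_scale scaleC_scaleC)
  finally have "scaleC (d * d) (U e) = scaleC 1 (U e)" by simp
  then have "d * d = 1"
    by (rule scalar_unique) (simp add: U_norm e)
  then have "d = 1 \<or> d = -1"
    by (simp add: square_eq_1_iff)
  moreover have "U (\<Gamma> x) = scaleC d (\<Gamma> (U x))" for x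
    using d[of x] by (metis \<Gamma>(2) \<Gamma>_scale)
  ultimately have hom: "homogeneous \<Gamma> U"
    unfolding homogeneous_def by (auto simp: scaleC_minus1)

  have \<sigma>_eq: "\<sigma> T x = scaleC c (U (T (U x)))" if T: "T \<in> compact_operators" for T x
  proof -
    have "\<sigma> T (scaleC c x) = U (T (U x))"
      using inter[OF T, of "U x"] by (simp add: UU)
    moreover have "\<sigma> T (scaleC c x) = scaleC c (\<sigma> T x)"
      using \<sigma>K[OF T] by (simp add: compact_operators_def clinear_op_def)
    moreover have "c * c = 1" using c by auto
    ultimately show ?thesis
      by (metis scaleC_scaleC complex_vector.scale_one)
  qed
  show ?thesis
    using c
  proof
    assume "c = 1"
    then have "Real_structure_space \<Gamma> U" "\<forall>T\<in>compact_operators. \<sigma> T = (\<lambda>x. U (T (U x)))"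
      using U hom UU \<sigma>_eq by (auto simp: Real_structure_space_def)
    then show ?thesis by blast
  next
    assume "c = -1"
    then have "quaternionic_structure_space \<Gamma> U" "\<forall>T\<in>compact_operators. \<sigma> T = (\<lambda>x. - U (T (U x)))"
      using U hom UU \<sigma>_eq by (auto simp: quaternionic_structure_space_def scaleC_minus1)
    then show ?thesis by blast
  qed
qed

theorem propositionA13:
  fixes \<sigma> :: "('h::chilbert_space \<times> 'h \<Rightarrow> 'h \<times> 'h) \<Rightarrow> ('h \<times> 'h \<Rightarrow> 'h \<times> 'h)"
  assumes "separable_space (euclidean :: 'h topology)"
    and "infinite_cdim TYPE('h)"
    and "Real_structure_algebra compact_operators Khat_grading \<sigma>"
  shows "(\<exists>J. Real_structure_space prod.swap J \<and>
             (\<forall>T\<in>compact_operators. \<sigma> T = (\<lambda>x. J (T (J x))))) \<or>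
         (\<exists>J. quaternionic_structure_space prod.swap J \<and>
             (\<forall>T\<in>compact_operators. \<sigma> T = (\<lambda>x. - J (T (J x)))))"
proof -
  have "\<exists>v::'h. v \<noteq> 0"
  proof (rule ccontr)
    assume "\<not> (\<exists>v::'h. v \<noteq> 0)"
    then have "complex_vector.span {} = (UNIV :: 'h set)"
      by auto
    then show False
      using assms(2) unfolding infinite_cdim_def by blast
  qed
  then obtain v :: 'h where "v \<noteq> 0" by blast
  then have e: "norm (sgn v, 0::'h) = 1"
    by (simp add: norm_prod_def norm_sgn)
  show ?thesis
    by (rule Real_structure_algebra_spatial[OF assms(3) _ _ _ e])
      (auto simp: clinear_op_def scaleC_prod_def cinner_prod_def add.commute)
qed

end
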